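(* Let $(V_1,V_2)$, $L_\omega$ and the weighted norm $\|\cdot\|_{C^0_\theta((-R,R))}$ be as in the context. Given $\theta>0$, there exist constants $C,R_0,\omega_0,P_0>0$ such that the following holds. If $$R>R_0,\qquad \omega\in(0,\omega_0),\qquad \omega R>P_0,$$ and $\varphi=(\varphi_1,\varphi_2)$, $g=(g_1,g_2)$ satisfy $$L_\omega\varphi=g\ \text{ for } x\in(-R,R),\qquad \varphi(\pm R)=0,$$ then $$\|\varphi\|_{C^0((-R,R))}\le C\,\omega^{-1}\,\|g\|_{C^0_\theta((-R,R))}.$$
   Context: The pair $(V_1,V_2)$, with $V_1,V_2>0$ on $\mathbb{R}$, denotes the (existing and unique, by known results) solution of $$-V_1''+V_1V_2^2=0,\qquad -V_2''+V_2V_1^2=0\quad\text{in }\mathbb{R},$$ with $V_1(0)=V_2(0)=1$, $V_1(-x)=V_2(x)$ and $V_1'(x)>0$ for $x\in\mathbb{R}$, and with $$V_1(x)=Ax+B+\mathcal{O}(e^{-cx^2})\ \text{ as }x\to+\infty,\qquad V_1(x)=\mathcal{O}(e^{-cx^2})\ \text{ as }x\to-\infty,$$ for some constants $A>0$, $B\in\mathbb{R}$, $c>0$. For $\omega\ge 0$, the linear operator $L_\omega$ acts on pairs $\varphi=(\varphi_1,\varphi_2)$ of real-valued functions of one variable $x$ by $$L_\omega\varphi=\begin{pmatrix}-\varphi_1''+V_2^2\varphi_1+2V_1V_2\varphi_2+\omega^2\varphi_1\\ -\varphi_2''+V_1^2\varphi_2+2V_1V_2\varphi_1+\omega^2\varphi_2\end{pmatrix}.$$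 Solutions are understood in the classical sense: $g=(g_1,g_2)$ is a pair of continuous functions on $(-R,R)$, and $\varphi_1,\varphi_2$ are $C^2$ in $(-R,R)$ and continuous on $[-R,R]$. $\|\cdot\|_{C^0((-R,R))}$ is the supremum norm of a pair of functions on $(-R,R)$ (e.g. the maximum of the suprema of the absolute values of the two components), and for $\theta>0$, $$\|g\|_{C^0_\theta((-R,R))}=\|g\cosh(\theta x)\|_{C^0((-R,R))}.$$ The constants $C,R_0,\omega_0,P_0$ do not depend on $R,\omega,\varphi,g$. *)

theory Defs
  imports "HOL-Analysis.Analysis" "HOL-Library.Landau_Symbols"
begin

text \<open>Only used for open \<open>S\<close>: \<open>deriv\<close> is the two-sided derivative and has a meaningful value only
  where the function is differentiable, so differentiability is required separately.\<close>

definition C2_on :: "real set \<Rightarrow> (real \<Rightarrow> real) \<Rightarrow> bool" where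
  "C2_on S f \<longleftrightarrow>
     (\<forall>x\<in>S. f field_differentiable at x) \<and>
     (\<forall>x\<in>S. deriv f field_differentiable at x) \<and>
     continuous_on S (deriv (deriv f))"

definition entire_profile :: "(real \<Rightarrow> real) \<Rightarrow> (real \<Rightarrow> real) \<Rightarrow> bool" where
  "entire_profile V1 V2 \<longleftrightarrow>
     C2_on UNIV V1 \<and> C2_on UNIV V2 \<and>
     (\<forall>x. V1 x > 0) \<and> (\<forall>x. V2 x > 0) \<and>
     (\<forall>x. - deriv (deriv V1) x + V1 x * (V2 x)\<^sup>2 = 0) \<and>
     (\<forall>x. - deriv (deriv V2) x + V2 x * (V1 x)\<^sup>2 = 0) \<and>
     V1 0 = 1 \<and> V2 0 = 1 \<and>
     (\<forall>x. V1 (- x) = V2 x) \<and>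
     (\<forall>x. deriv V1 x > 0) \<and>
     (\<exists>A B c. A > 0 \<and> c > 0 \<and>
        (\<lambda>x. V1 x - (A * x + B)) \<in> O[at_top](\<lambda>x. exp (- c * x\<^sup>2)) \<and>
        V1 \<in> O[at_bot](\<lambda>x. exp (- c * x\<^sup>2)))"

definition L_op :: "(real \<Rightarrow> real) \<Rightarrow> (real \<Rightarrow> real) \<Rightarrow> real \<Rightarrow>
    (real \<Rightarrow> real) \<Rightarrow> (real \<Rightarrow> real) \<Rightarrow> real \<Rightarrow> real \<times> real" where
  "L_op V1 V2 \<omega> \<phi>1 \<phi>2 x =
     (- deriv (deriv \<phi>1) x + (V2 x)\<^sup>2 * \<phi>1 x + 2 * V1 x * V2 x * \<phi>2 x + \<omega>\<^sup>2 * \<phi>1 x,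
      - deriv (deriv \<phi>2) x + (V1 x)\<^sup>2 * \<phi>2 x + 2 * V1 x * V2 x * \<phi>1 x + \<omega>\<^sup>2 * \<phi>2 x)"

text \<open>The norms take values in \<open>ennreal\<close>, so that they are \<open>\<infinity>\<close> for unbounded functions: the
  right-hand side \<open>g\<close> is only assumed continuous on the open interval.\<close>

definition C0_norm :: "real \<Rightarrow> (real \<Rightarrow> real) \<Rightarrow> (real \<Rightarrow> real) \<Rightarrow> ennreal" where
  "C0_norm R f1 f2 = (SUP x\<in>{-R<..<R}. ennreal (max \<bar>f1 x\<bar> \<bar>f2 x\<bar>))"

definition C0_weighted_norm ::
    "real \<Rightarrow> real \<Rightarrow> (real \<Rightarrow> real) \<Rightarrow> (real \<Rightarrow> real) \<Rightarrow> ennreal" where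
  "C0_weighted_norm \<theta> R f1 f2 =
     C0_norm R (\<lambda>x. f1 x * cosh (\<theta> * x)) (\<lambda>x. f2 x * cosh (\<theta> * x))"

definition dirichlet_solution :: "(real \<Rightarrow> real) \<Rightarrow> (real \<Rightarrow> real) \<Rightarrow> real \<Rightarrow> real \<Rightarrow>
    (real \<Rightarrow> real) \<Rightarrow> (real \<Rightarrow> real) \<Rightarrow> (real \<Rightarrow> real) \<Rightarrow> (real \<Rightarrow> real) \<Rightarrow> bool" where
  "dirichlet_solution V1 V2 R \<omega> \<phi>1 \<phi>2 g1 g2 \<longleftrightarrow>
     continuous_on {-R<..<R} g1 \<and> continuous_on {-R<..<R} g2 \<and>
     C2_on {-R<..<R} \<phi>1 \<and> C2_on {-R<..<R} \<phi>2 \<and>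
     continuous_on {-R..R} \<phi>1 \<and> continuous_on {-R..R} \<phi>2 \<and>
     (\<forall>x\<in>{-R<..<R}. L_op V1 V2 \<omega> \<phi>1 \<phi>2 x = (g1 x, g2 x)) \<and>
     \<phi>1 (-R) = 0 \<and> \<phi>1 R = 0 \<and> \<phi>2 (-R) = 0 \<and> \<phi>2 R = 0"

end

theory Submission
  imports Defs
begin

text \<open>
  After the substitution \<open>\<phi>\<^sub>2 \<mapsto> - \<phi>\<^sub>2\<close> the operator \<open>L\<^sub>\<omega>\<close> becomes cooperative (its off-diagonal
  entries are \<open>- 2 V\<^sub>1 V\<^sub>2 \<le> 0\<close>), so a positive pair \<open>(S\<^sub>1, S\<^sub>2)\<close> whose image has both components
  at least \<open>1 / cosh (\<theta> x)\<close> gives \<open>\<bar>\<phi>\<^sub>i\<bar> \<le> \<parallel>g\<parallel> S\<^sub>i\<close>, and it suffices to find such a pair with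
  \<open>S\<^sub>i \<le> C / \<omega>\<close>. In the new unknowns \<open>w = (V\<^sub>1', - V\<^sub>2')\<close> is a positive element of the kernel of
  \<open>L\<^sub>0\<close>, and with \<open>v = (V\<^sub>1, - V\<^sub>2)\<close> every scalar function \<open>\<eta>\<close> satisfies
  \<open>L\<^sub>0 (\<eta> w + \<eta>' v) = - 3 \<eta>'' w - \<eta>''' v\<close>. Taking for \<open>\<eta>\<close> an even function of height of order
  \<open>1 / \<omega>\<close> that varies on the scale \<open>1 / \<omega>\<close> and is strictly concave near \<open>0\<close>, \<open>L\<^sub>\<omega> (\<eta> w + \<eta>' v)\<close>
  is positive; it decays only algebraically except where \<open>V\<^sub>1\<close> or \<open>V\<^sub>2\<close> supplies a large potential,
  so adding \<open>1 / cosh (\<theta> x)\<close> to both components yields \<open>S\<close> after scaling.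
\<close>

section \<open>Comparison with a strict supersolution\<close>

text \<open>If \<open>l < 0\<close>, then \<open>z'\<close>, which vanishes at \<open>x0\<close>, is
  negative just to the right of \<open>x0\<close>, and the mean value theorem pushes
  \<open>z\<close> below its minimum.\<close>

lemma second_deriv_nonneg_at_interior_min:
  fixes z :: "real \<Rightarrow> real"
  assumes x0: "x0 \<in> {a<..<b}"
    and z1: "\<And>x. x \<in> {a<..<b} \<Longrightarrow> (z has_real_derivative z' x) (at x)"
    and z2: "(z' has_real_derivative l) (at x0)"
    and min: "\<And>x. x \<in> {a<..<b} \<Longrightarrow> z x0 \<le> z x"
  shows "0 \<le> l"
proof (rule ccontr)
  assume "\<not> 0 \<le> l"
  then have l: "l < 0" by simp
  define e where "e = min (x0 - a) (b - x0)"
  have e: "e > 0" using x0 by (auto simp: e_def)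
  have "z' x0 = 0"
    by (rule DERIV_local_min[OF z1[OF x0] e]) (use min in \<open>auto simp: e_def abs_less_iff\<close>)
  moreover obtain d where d: "d > 0" "\<And>h. h > 0 \<Longrightarrow> h < d \<Longrightarrow> z' (x0 + h) < z' x0"
    using DERIV_neg_dec_right[OF z2 l] by blast
  ultimately have neg: "\<And>h. h > 0 \<Longrightarrow> h < d \<Longrightarrow> z' (x0 + h) < 0" by simp
  define h where "h = min d e / 2"
  have h: "h > 0" "h < d" "h < e" using d(1) e by (auto simp: h_def min_def)
  have "\<exists>y>x0. y < x0 + h \<and> z (x0 + h) - z x0 = (x0 + h - x0) * z' y"
    by (rule MVT2) (use h x0 in \<open>auto intro!: z1 simp: e_def\<close>)
  then obtain y where y: "y > x0" "y < x0 + h" "z (x0 + h) - z x0 = h * z' y" by auto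
  have "z' y < 0" using neg[of "y - x0"] y h by simp
  then have "h * z' y < 0" using h by (simp add: mult_pos_neg)
  moreover have "z x0 \<le> z (x0 + h)" using h x0 by (intro min) (auto simp: e_def)
  ultimately show False using y by linarith
qed

text \<open>One component of the comparison; the other enters only through its value
  \<open>\<psi>\<close> at \<open>x0\<close> and the bound \<open>t * Q\<close>. The coupling
  appears with opposite signs in \<open>eq\<close> and \<open>super\<close>: bounding absolute
  values stands in for the substitution that makes the system cooperative.\<close>

lemma no_interior_touching:
  fixes \<phi> S :: "real \<Rightarrow> real"
  assumes x0: "x0 \<in> {a<..<b}"
    and phi1: "\<And>x. x \<in> {a<..<b} \<Longrightarrow> (\<phi> has_real_derivative \<phi>' x) (at x)"
    and phi2: "(\<phi>' has_real_derivative \<phi>'') (at x0)"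
    and S1: "\<And>x. x \<in> {a<..<b} \<Longrightarrow> (S has_real_derivative S' x) (at x)"
    and S2: "(S' has_real_derivative S'') (at x0)"
    and eq: "- \<phi>'' + c * \<phi> x0 + k * \<psi> = g"
    and super: "- S'' + c * S x0 - k * Q \<ge> e"
    and k: "k \<ge> 0" and e: "e > 0" and g: "\<bar>g\<bar> \<le> G * e"
    and le: "\<And>x. x \<in> {a<..<b} \<Longrightarrow> \<bar>\<phi> x\<bar> \<le> t * S x" and psi: "\<bar>\<psi>\<bar> \<le> t * Q"
    and t: "t \<ge> 0" "G < t"
  shows "\<bar>\<phi> x0\<bar> \<noteq> t * S x0"
proof
  assume touch: "\<bar>\<phi> x0\<bar> = t * S x0"
  \<comment> \<open>With \<open>s\<close> the sign of \<open>\<phi> x0\<close>, the function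
    \<open>t * S - s * \<phi>\<close> is nonnegative and has its minimum \<open>0\<close> at
    \<open>x0\<close>.\<close>
  obtain s :: real where s: "s = 1 \<or> s = -1" "s * \<phi> x0 = t * S x0"
    using touch by (metis abs_if mult_1 mult_minus1)
  have "0 \<le> t * S'' - s * \<phi>''"
  proof (rule second_deriv_nonneg_at_interior_min[OF x0])
    show "((\<lambda>x. t * S x - s * \<phi> x) has_real_derivative t * S' x - s * \<phi>' x) (at x)"
      if "x \<in> {a<..<b}" for x
      by (intro DERIV_diff DERIV_cmult S1 phi1 that)
    show "((\<lambda>x. t * S' x - s * \<phi>' x) has_real_derivative t * S'' - s * \<phi>'') (at x0)"
      by (intro DERIV_diff DERIV_cmult S2 phi2)
    show "t * S x0 - s * \<phi> x0 \<le> t * S x - s * \<phi> x" if "x \<in> {a<..<b}" for x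
      using s le[OF that] by auto
  qed
  \<comment> \<open>All three terms on the right are nonpositive: the first by minimality, the
    second vanishes by touching, the third since
    \<open>\<bar>\<psi>\<bar> \<le> t * Q\<close>.\<close>
  moreover have "t * (- S'' + c * S x0 - k * Q) - s * (- \<phi>'' + c * \<phi> x0 + k * \<psi>)
      = - (t * S'' - s * \<phi>'') + c * (t * S x0 - s * \<phi> x0) - k * (t * Q + s * \<psi>)"
    by (simp add: algebra_simps)
  moreover have "k * (t * Q + s * \<psi>) \<ge> 0"
    using k s(1) psi by (intro mult_nonneg_nonneg) auto
  ultimately have "t * (- S'' + c * S x0 - k * Q) - s * g \<le> 0"
    using s(2) eq by simp
  moreover have "t * (- S'' + c * S x0 - k * Q) \<ge> t * e"
    using super t by (intro mult_left_mono) auto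
  moreover have "s * g \<le> G * e" using s(1) g by auto
  moreover have "G * e < t * e" using t e by simp
  ultimately show False by linarith
qed

text \<open>Let \<open>t\<close> be the largest value of the ratios
  \<open>\<bar>\<phi>i\<bar> / Si\<close>. If \<open>t > G\<close>, it is attained in the interior,
  because both ratios vanish at the endpoints, and there some \<open>\<bar>\<phi>i\<bar>\<close>
  touches \<open>t * Si\<close>, which \<open>no_interior_touching\<close> excludes.\<close>

lemma bound_by_strict_supersolution:
  fixes \<phi>1 \<phi>2 S1 S2 :: "real \<Rightarrow> real"
  assumes phi1: "\<And>x. x \<in> {-R<..<R} \<Longrightarrow> (\<phi>1 has_real_derivative \<phi>1' x) (at x)"
      "\<And>x. x \<in> {-R<..<R} \<Longrightarrow> (\<phi>1' has_real_derivative \<phi>1'' x) (at x)"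
    and phi2: "\<And>x. x \<in> {-R<..<R} \<Longrightarrow> (\<phi>2 has_real_derivative \<phi>2' x) (at x)"
      "\<And>x. x \<in> {-R<..<R} \<Longrightarrow> (\<phi>2' has_real_derivative \<phi>2'' x) (at x)"
    and S1: "\<And>x. (S1 has_real_derivative S1' x) (at x)"
      "\<And>x. (S1' has_real_derivative S1'' x) (at x)"
    and S2: "\<And>x. (S2 has_real_derivative S2' x) (at x)"
      "\<And>x. (S2' has_real_derivative S2'' x) (at x)"
    and eq: "\<And>x. x \<in> {-R<..<R} \<Longrightarrow> - \<phi>1'' x + c1 x * \<phi>1 x + k x * \<phi>2 x = g1 x"
      "\<And>x. x \<in> {-R<..<R} \<Longrightarrow> - \<phi>2'' x + c2 x * \<phi>2 x + k x * \<phi>1 x = g2 x"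
    and super: "\<And>x. - S1'' x + c1 x * S1 x - k x * S2 x \<ge> e x"
      "\<And>x. - S2'' x + c2 x * S2 x - k x * S1 x \<ge> e x"
    and pos: "\<And>x. k x \<ge> 0" "\<And>x. e x > 0" "\<And>x. S1 x > 0" "\<And>x. S2 x > 0"
    and g: "\<And>x. x \<in> {-R<..<R} \<Longrightarrow> \<bar>g1 x\<bar> \<le> G * e x"
      "\<And>x. x \<in> {-R<..<R} \<Longrightarrow> \<bar>g2 x\<bar> \<le> G * e x"
    and cont: "continuous_on {-R..R} \<phi>1" "continuous_on {-R..R} \<phi>2"
    and bdry: "\<phi>1 (-R) = 0" "\<phi>1 R = 0" "\<phi>2 (-R) = 0" "\<phi>2 R = 0"
    and R: "R > 0" and G: "G \<ge> 0" and x: "x \<in> {-R..R}"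
  shows "\<bar>\<phi>1 x\<bar> \<le> G * S1 x" "\<bar>\<phi>2 x\<bar> \<le> G * S2 x"
proof -
  define f where "f x = max (\<bar>\<phi>1 x\<bar> / S1 x) (\<bar>\<phi>2 x\<bar> / S2 x)" for x
  have contS: "continuous_on {-R..R} S1" "continuous_on {-R..R} S2"
    using S1(1) S2(1) by (meson DERIV_isCont continuous_at_imp_continuous_on)+
  have "S1 x \<noteq> 0" "S2 x \<noteq> 0" for x using pos(3,4)[of x] by auto
  then have "continuous_on {-R..R} f"
    unfolding f_def by (intro continuous_intros contS cont) auto
  then obtain x0 where x0: "x0 \<in> {-R..R}" and fmax: "\<And>x. x \<in> {-R..R} \<Longrightarrow> f x \<le> f x0"
    using continuous_attains_sup[of "{-R..R}" f] R by auto
  define t where "t = f x0"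
  have le: "\<bar>\<phi>1 x\<bar> \<le> t * S1 x" "\<bar>\<phi>2 x\<bar> \<le> t * S2 x" if "x \<in> {-R..R}" for x
    using fmax[OF that] pos(3,4)[of x] by (auto simp: f_def t_def pos_divide_le_eq)
  have t0: "t \<ge> 0"
  proof -
    have "\<bar>\<phi>1 x0\<bar> / S1 x0 \<ge> 0" using pos(3)[of x0] by (intro divide_nonneg_pos) auto
    then show ?thesis unfolding t_def f_def by simp
  qed
  have "t \<le> G"
  proof (rule ccontr)
    assume "\<not> t \<le> G"
    then have tG: "G < t" by simp
    have "x0 \<noteq> R" "x0 \<noteq> -R" using tG G bdry by (auto simp: t_def f_def)
    then have x0': "x0 \<in> {-R<..<R}" using x0 by auto
    have "\<bar>\<phi>1 x0\<bar> \<noteq> t * S1 x0"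
      by (rule no_interior_touching[OF x0' phi1(1) phi1(2)[OF x0'] S1(1) S1(2) eq(1)[OF x0'] super(1)
          pos(1,2) g(1)[OF x0'] le(1) le(2)[OF x0] t0 tG]) auto
    moreover have "\<bar>\<phi>2 x0\<bar> \<noteq> t * S2 x0"
      by (rule no_interior_touching[OF x0' phi2(1) phi2(2)[OF x0'] S2(1) S2(2) eq(2)[OF x0'] super(2)
          pos(1,2) g(2)[OF x0'] le(2) le(1)[OF x0] t0 tG]) auto
    moreover have "t = \<bar>\<phi>1 x0\<bar> / S1 x0 \<or> t = \<bar>\<phi>2 x0\<bar> / S2 x0"
      by (auto simp: t_def f_def max_def)
    ultimately show False using pos(3,4)[of x0] by (auto simp: field_simps)
  qed
  then have "t * S1 x \<le> G * S1 x" "t * S2 x \<le> G * S2 x"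
    using pos(3,4)[of x] by (auto intro: mult_right_mono)
  with le[OF x] show "\<bar>\<phi>1 x\<bar> \<le> G * S1 x" "\<bar>\<phi>2 x\<bar> \<le> G * S2 x" by auto
qed

section \<open>The modulating functions\<close>

lemma arctan_ge_div: "t / (1 + t\<^sup>2) \<le> arctan t" if "t \<ge> 0" for t :: real
proof -
  have "arctan 0 - 0 / (1 + 0\<^sup>2) \<le> arctan t - t / (1 + t\<^sup>2)"
  proof (rule DERIV_nonneg_imp_nondecreasing[OF that])
    fix x :: real
    have p: "1 + x\<^sup>2 \<noteq> 0" by (metis add_pos_nonneg less_irrefl zero_le_power2 zero_less_one)
    have "((\<lambda>t. arctan t - t / (1 + t\<^sup>2)) has_real_derivative
        inverse (1 + x\<^sup>2) - (1 * (1 + x\<^sup>2) - x * (2 * x)) / ((1 + x\<^sup>2) * (1 + x\<^sup>2))) (at x)"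
      using p by (auto intro!: derivative_eq_intros)
    also have "inverse (1 + x\<^sup>2) - (1 * (1 + x\<^sup>2) - x * (2 * x)) / ((1 + x\<^sup>2) * (1 + x\<^sup>2))
        = 2 * x\<^sup>2 / (1 + x\<^sup>2)\<^sup>2"
      using p by (simp add: divide_simps) (simp add: algebra_simps power2_eq_square)
    finally show "\<exists>y. ((\<lambda>t. arctan t - t / (1 + t\<^sup>2)) has_real_derivative y) (at x) \<and> 0 \<le> y"
      by (intro exI conjI) auto
  qed
  then show ?thesis by simp
qed

text \<open>Both sides vanish at \<open>0\<close>, and their difference has derivative
  \<open>arctan t - t / (1 + t\<^sup>2)\<close>, nonnegative for \<open>t \<ge> 0\<close> by
  \<open>arctan_ge_div\<close>; both sides are even.\<close>

lemma ln_le_mult_arctan: "ln (1 + t\<^sup>2) \<le> t * arctan t" for t :: real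
proof -
  have main: "ln (1 + t\<^sup>2) \<le> t * arctan t" if "t \<ge> 0" for t :: real
  proof -
    have "0 * arctan 0 - ln (1 + 0\<^sup>2) \<le> t * arctan t - ln (1 + t\<^sup>2)"
    proof (rule DERIV_nonneg_imp_nondecreasing[OF that])
      fix x :: real
      assume "0 \<le> x"
      have p: "1 + x\<^sup>2 > 0" by (simp add: add_pos_nonneg)
      then have "((\<lambda>t. t * arctan t - ln (1 + t\<^sup>2)) has_real_derivative
          (arctan x + x * inverse (1 + x\<^sup>2)) - 2 * x / (1 + x\<^sup>2)) (at x)"
        by (auto intro!: derivative_eq_intros simp: divide_inverse)
      also have "(arctan x + x * inverse (1 + x\<^sup>2)) - 2 * x / (1 + x\<^sup>2) = arctan x - x / (1 + x\<^sup>2)"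
        by (simp add: divide_inverse)
      finally show "\<exists>y. ((\<lambda>t. t * arctan t - ln (1 + t\<^sup>2)) has_real_derivative y) (at x) \<and> 0 \<le> y"
        using arctan_ge_div[OF \<open>0 \<le> x\<close>] by (intro exI conjI) auto
    qed
    then show ?thesis by simp
  qed
  show ?thesis
    using main[of t] main[of "-t"] by (cases "t \<ge> 0") (auto simp: arctan_minus)
qed

lemma arctan_abs_less_2: "\<bar>arctan y\<bar> < 2"
  using arctan_bounded[of y] pi_half_less_two by (auto simp: abs_less_iff)

text \<open>A smooth version of \<open>\<bar>x\<bar>\<close>, up to a factor. Its second derivative \<open>M / (M\<^sup>2 + x\<^sup>2)\<close> decays
  slowly enough that \<open>3 * bend'' * V' + bend''' * V\<close> stays positive for linearly growing \<open>V\<close>.\<close>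

definition bend :: "real \<Rightarrow> real \<Rightarrow> real" where
  "bend M x = x * arctan (x / M) - M / 2 * ln (1 + (x / M)\<^sup>2)"

context
  fixes M :: real
  assumes M: "M > 0"
begin

lemma DERIV_arctan_scaled: "((\<lambda>x. arctan (x / M)) has_real_derivative M / (M\<^sup>2 + x\<^sup>2)) (at x)"
proof -
  have "M\<^sup>2 + x\<^sup>2 \<noteq> 0" using M by (auto simp: sum_power2_eq_zero_iff)
  then show ?thesis using M
    by (auto intro!: derivative_eq_intros simp: field_simps power2_eq_square)
qed

lemma DERIV_arctan_scaled2:
  "((\<lambda>x. M / (M\<^sup>2 + x\<^sup>2)) has_real_derivative - 2 * M * x / (M\<^sup>2 + x\<^sup>2)\<^sup>2) (at x)"
proof -
  have "M\<^sup>2 + x\<^sup>2 \<noteq> 0" using M by (auto simp: sum_power2_eq_zero_iff)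
  then show ?thesis using M
    by (auto intro!: derivative_eq_intros simp: field_simps power2_eq_square)
qed

lemma DERIV_bend: "(bend M has_real_derivative arctan (x / M)) (at x)"
proof -
  have p: "1 + (x / M)\<^sup>2 > 0" by (simp add: add_pos_nonneg)
  have ne: "M\<^sup>2 + x\<^sup>2 \<noteq> 0" using M by (auto simp: sum_power2_eq_zero_iff)
  have "((\<lambda>x. x * arctan (x / M) - M / 2 * ln (1 + (x / M)\<^sup>2)) has_real_derivative
     (1 * arctan (x / M) + M / (M\<^sup>2 + x\<^sup>2) * x) - M / 2 * (2 * (x / M) * (1 / M) / (1 + (x / M)\<^sup>2))) (at x)"
  proof (intro DERIV_diff DERIV_mult DERIV_cmult DERIV_arctan_scaled DERIV_ident)
    show "((\<lambda>x. ln (1 + (x / M)\<^sup>2)) has_real_derivative 2 * (x / M) * (1 / M) / (1 + (x / M)\<^sup>2)) (at x)"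
      using p by (auto intro!: derivative_eq_intros simp: divide_inverse)
  qed
  moreover have "M / 2 * (2 * (x / M) * (1 / M) / (1 + (x / M)\<^sup>2)) = x * (M / (M\<^sup>2 + x\<^sup>2))"
    using M ne p by (simp add: divide_simps) (simp add: algebra_simps power2_eq_square)
  ultimately show ?thesis unfolding bend_def[abs_def] by (simp add: mult.commute)
qed

text \<open>As \<open>arctan (x / M)\<close> is the derivative of \<open>bend M\<close>, this is a
  growth condition of the form \<open>x * f' \<le> 2 * f\<close>.\<close>

lemma bend_ge: "x * arctan (x / M) \<le> 2 * bend M x"
proof -
  have "M * ln (1 + (x / M)\<^sup>2) \<le> M * (x / M * arctan (x / M))"
    using M by (intro mult_left_mono ln_le_mult_arctan) auto
  then show ?thesis using M by (simp add: bend_def)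
qed

lemma mult_arctan_nonneg: "0 \<le> x * arctan (x / M)"
  using M by (cases "x \<ge> 0") (auto intro!: mult_nonneg_nonneg mult_nonpos_nonpos simp: divide_nonpos_pos)

lemma bend_nonneg: "0 \<le> bend M x"
  using bend_ge[of x] mult_arctan_nonneg[of x] by linarith

lemma bend_le: "bend M x \<le> 2 * \<bar>x\<bar>"
proof -
  have "M / 2 * ln (1 + (x / M)\<^sup>2) \<ge> 0" using M by (intro mult_nonneg_nonneg ln_ge_zero) auto
  then have "bend M x \<le> x * arctan (x / M)" by (simp add: bend_def)
  also have "\<dots> = \<bar>x\<bar> * \<bar>arctan (x / M)\<bar>"
    using mult_arctan_nonneg[of x] by (metis abs_mult abs_of_nonneg)
  also have "\<dots> \<le> \<bar>x\<bar> * 2"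
    using arctan_abs_less_2[of "x / M"] by (intro mult_left_mono) auto
  finally show ?thesis by simp
qed

lemma bend_minus: "bend M (- x) = bend M x"
  by (simp add: bend_def arctan_minus)

end

section \<open>The amplitude and its first three derivatives\<close>

context
  fixes M \<nu> :: real
  assumes M: "M > 0" and nu: "\<nu> > 0"
begin

private abbreviation "s0 x \<equiv> bend M x"
private abbreviation "s1 x \<equiv> arctan (x / M)"
private abbreviation "s2 x \<equiv> M / (M\<^sup>2 + x\<^sup>2)"
private abbreviation "s3 x \<equiv> - 2 * M * x / (M\<^sup>2 + x\<^sup>2)\<^sup>2"

text \<open>With the square root as the basic unit, each differentiation of a power
  \<open>1 / r ^ n\<close> raises \<open>n\<close> by 2, so only odd powers of \<open>r\<close>
  occur below.\<close>

definition "rad x = sqrt (1 + \<nu> * s0 x)"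

private abbreviation "r \<equiv> rad"

lemma rad_ge_1: "r x \<ge> 1"
  using bend_nonneg[OF M, of x] nu by (simp add: rad_def)

lemma rad_squared: "(r x)\<^sup>2 = 1 + \<nu> * s0 x"
  using bend_nonneg[OF M, of x] nu by (simp add: rad_def)

lemma DERIV_rad: "(r has_real_derivative \<nu> * s1 x / (2 * r x)) (at x)"
proof -
  have "1 + \<nu> * s0 x > 0" using bend_nonneg[OF M, of x] nu by (simp add: add_pos_nonneg)
  then show ?thesis unfolding rad_def[abs_def]
    by (auto intro!: derivative_eq_intros DERIV_bend[OF M] simp: divide_simps)
qed

lemma DERIV_inverse_rad_power:
  "((\<lambda>x. 1 / r x ^ n) has_real_derivative - (n * \<nu> / 2) * s1 x / r x ^ (n + 2)) (at x)"
proof -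
  have r: "r x > 0" using rad_ge_1[of x] by linarith
  have "((\<lambda>x. 1 / r x ^ n) has_real_derivative
      - (n * r x ^ (n - 1) * (\<nu> * s1 x / (2 * r x))) / (r x ^ n * r x ^ n)) (at x)"
    using r by (auto intro!: derivative_eq_intros DERIV_rad)
  also have "- (n * r x ^ (n - 1) * (\<nu> * s1 x / (2 * r x))) / (r x ^ n * r x ^ n)
      = - (n * \<nu> / 2) * s1 x / r x ^ (n + 2)"
  proof (cases n)
    case (Suc m)
    then show ?thesis using r by (simp add: divide_simps)
  qed simp
  finally show ?thesis .
qed

text \<open>Decaying only like the power \<open>- 1 / 2\<close> of \<open>1 + \<nu> * bend M x\<close> keeps
  \<open>amp x - x * slope x\<close> nonnegative (by \<open>bend_ge\<close>); exponential decay would not.\<close>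

definition "amp x = 2 / \<nu> * (1 / r x ^ 1)"
definition "slope x = s1 x * (1 / r x ^ 3)"
definition "slope' x = s2 x / r x ^ 3 - 3 / 2 * \<nu> * (s1 x)\<^sup>2 / r x ^ 5"
definition "slope'' x = s3 x / r x ^ 3 - 9 / 2 * \<nu> * s1 x * s2 x / r x ^ 5
  + 15 / 4 * \<nu>\<^sup>2 * s1 x ^ 3 / r x ^ 7"

lemma DERIV_amp: "(amp has_real_derivative - slope x) (at x)"
  unfolding amp_def[abs_def]
  by (rule DERIV_cong[OF DERIV_cmult[OF DERIV_inverse_rad_power]])
    (use nu in \<open>simp add: slope_def numeral_3_eq_3\<close>)

lemma DERIV_slope: "(slope has_real_derivative slope' x) (at x)"
  unfolding slope_def[abs_def]
  by (rule DERIV_cong[OF DERIV_mult[OF DERIV_arctan_scaled[OF M] DERIV_inverse_rad_power]])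
    (simp add: slope'_def power2_eq_square field_simps)

lemma DERIV_slope': "(slope' has_real_derivative slope'' x) (at x)"
proof -
  \<comment> \<open>The powers of \<open>r\<close> become independent variables \<open>p\<close>,
    \<open>q\<close>, \<open>s\<close>, so that only terms have to be collected.\<close>
  have alg: "(c * (1 / p) + - (3 * \<nu> / 2) * a / q * b)
     - 3 / 2 * \<nu> * ((2 * a * b) * (1 / q) + - (5 * \<nu> / 2) * a / s * a\<^sup>2)
     = c / p - 9 / 2 * \<nu> * a * b / q + 15 / 4 * \<nu>\<^sup>2 * a ^ 3 / s" for a b c p q s :: real
    by (simp add: power2_eq_square power3_eq_cube algebra_simps)
  have "((\<lambda>x. s2 x * (1 / r x ^ 3) - 3 / 2 * \<nu> * ((s1 x)\<^sup>2 * (1 / r x ^ 5))) has_real_derivative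
     (s3 x * (1 / r x ^ 3) + - ((3::nat) * \<nu> / 2) * s1 x / r x ^ (3 + 2) * s2 x)
     - 3 / 2 * \<nu> * ((2 * s1 x * s2 x) * (1 / r x ^ 5)
        + - ((5::nat) * \<nu> / 2) * s1 x / r x ^ (5 + 2) * (s1 x)\<^sup>2)) (at x)"
    by (intro DERIV_diff DERIV_mult DERIV_cmult DERIV_inverse_rad_power DERIV_arctan_scaled2[OF M])
      (rule DERIV_cong[OF DERIV_power[OF DERIV_arctan_scaled[OF M]]], simp)
  also have "(s3 x * (1 / r x ^ 3) + - ((3::nat) * \<nu> / 2) * s1 x / r x ^ (3 + 2) * s2 x)
     - 3 / 2 * \<nu> * ((2 * s1 x * s2 x) * (1 / r x ^ 5)
        + - ((5::nat) * \<nu> / 2) * s1 x / r x ^ (5 + 2) * (s1 x)\<^sup>2) = slope'' x"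
    using alg[of "s3 x" "r x ^ 3" "s1 x" "r x ^ 5" "s2 x" "r x ^ 7"] by (simp add: slope''_def)
  finally show ?thesis unfolding slope'_def[abs_def] by simp
qed

lemma slope_minus: "slope (- x) = - slope x" and amp_minus: "amp (- x) = amp x"
  by (simp_all add: slope_def amp_def rad_def bend_minus[OF M] arctan_minus)

end

lemma power_div_fact_le_exp: "x ^ n / fact n \<le> exp x" if "x \<ge> 0" for x :: real
proof -
  have "(\<Sum>k\<in>{n}. x ^ k /\<^sub>R fact k) \<le> (\<Sum>k. x ^ k /\<^sub>R fact k)"
    using that summable_exp_generic[of x] by (intro sum_le_suminf) auto
  then show ?thesis by (simp add: exp_def divide_inverse_commute)
qed

section \<open>Increasing profiles\<close>

text \<open>Here \<open>V\<close> and \<open>W\<close> stand for \<open>V\<^sub>1\<close> and \<open>V\<^sub>1'\<close>; the reflection symmetry replaces \<open>V\<^sub>2\<close> by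
  \<open>x \<mapsto> V (- x)\<close>.\<close>

locale increasing_profile =
  fixes V W :: "real \<Rightarrow> real"
  assumes DERIV_V: "(V has_real_derivative W x) (at x)"
    and DERIV_W: "(W has_real_derivative V x * (V (- x))\<^sup>2) (at x)"
    and V_pos: "V x > 0" and W_pos: "W x > 0" and V_0: "V 0 = 1"
    and V_linear: "\<exists>C. \<forall>x\<ge>0. V x \<le> C * (1 + x)"
begin

section \<open>Convexity and growth of the profile\<close>

lemma V_mono:
  assumes "x \<le> y"
  shows "V x \<le> V y"
proof (rule DERIV_nonneg_imp_nondecreasing[OF assms])
  show "\<exists>d. (V has_real_derivative d) (at z) \<and> 0 \<le> d" for z
    using DERIV_V[of z] W_pos[of z] V_pos[of z] by (intro exI[of _ "W z"]) auto
qed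

lemma W_mono:
  assumes "x \<le> y"
  shows "W x \<le> W y"
proof (rule DERIV_nonneg_imp_nondecreasing[OF assms])
  show "\<exists>d. (W has_real_derivative d) (at z) \<and> 0 \<le> d" for z
    using DERIV_W[of z] W_pos[of z] V_pos[of z] by (intro exI[of _ "V z * (V (- z))\<^sup>2"]) auto
qed

lemma V_secant:
  assumes "x \<le> y"
  shows "V x + (y - x) * W x \<le> V y" "V y \<le> V x + (y - x) * W y"
proof -
  have "V x + (y - x) * W x \<le> V y \<and> V y \<le> V x + (y - x) * W y"
  proof (cases "x = y")
    case False
    with assms have "x < y" by simp
    then obtain z where z: "z > x" "z < y" "V y - V x = (y - x) * W z"
      using MVT2[OF \<open>x < y\<close> DERIV_V] by blast
    then have "(y - x) * W x \<le> (y - x) * W z" "(y - x) * W z \<le> (y - x) * W y"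
      by (intro mult_left_mono W_mono; simp)+
    then show ?thesis using z(3) by linarith
  qed auto
  then show "V x + (y - x) * W x \<le> V y" "V y \<le> V x + (y - x) * W y" by auto
qed

text \<open>Convexity gives \<open>V x \<le> V 0 + x * W x\<close>, and
  \<open>V 0 = 1 \<le> W x / W 0\<close>. This lets terms with \<open>V\<close> be absorbed into
  terms with \<open>W\<close> on the right half-line.\<close>

lemma V_le_mult_W:
  assumes "x \<ge> 0"
  shows "V x \<le> (1 / W 0 + x) * W x"
proof -
  have "1 \<le> W x / W 0" using W_mono[OF assms] W_pos[of 0] by simp
  then show ?thesis using V_secant(2)[OF assms] V_0 by (simp add: algebra_simps)
qed

text \<open>The tangent at \<open>x\<close>, followed up to \<open>2 * x\<close>, stays below
  \<open>V\<close>, which grows at most linearly.\<close>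

lemma W_bounded: "\<exists>B. \<forall>x. W x \<le> B"
proof -
  obtain C where C: "\<And>x. x \<ge> 0 \<Longrightarrow> V x \<le> C * (1 + x)" using V_linear by blast
  have C0: "C > 0" using C[of 0] V_0 by simp
  have ge1: "W x \<le> 3 * C" if "x \<ge> 1" for x
  proof -
    have "x * W x \<le> C * (1 + 2 * x)"
      using V_secant(1)[of x "2 * x"] C[of "2 * x"] V_pos[of x] that by simp
    also have "\<dots> \<le> C * (3 * x)" using that C0 by (intro mult_left_mono) auto
    also have "\<dots> = x * (3 * C)" by simp
    finally show ?thesis using that by simp
  qed
  have "W x \<le> 3 * C" for x
    using ge1[of x] ge1[of 1] W_mono[of x 1] by (cases "x \<ge> 1") auto
  then show ?thesis by blast
qed

text \<open>The length scale of \<open>bend\<close>, chosen so that \<open>V_le_mult_W\<close> reads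
  \<open>V x \<le> (M + x) * W x\<close>.\<close>

definition "M = 1 / W 0"

lemma M_pos: "M > 0" using W_pos by (simp add: M_def)

section \<open>The barrier and its image under the operator\<close>

context
  fixes \<nu> :: real
  assumes nu: "\<nu> > 0" "\<nu> \<le> 1 / 2" "\<nu> * M \<le> 1 / 2"
begin

private abbreviation "s0 x \<equiv> bend M x"
private abbreviation "s1 x \<equiv> arctan (x / M)"
private abbreviation "s2 x \<equiv> M / (M\<^sup>2 + x\<^sup>2)"
private abbreviation "s3 x \<equiv> - 2 * M * x / (M\<^sup>2 + x\<^sup>2)\<^sup>2"
private abbreviation "r \<equiv> rad M \<nu>"
private abbreviation "\<eta> \<equiv> amp M \<nu>"
private abbreviation "\<tau> \<equiv> slope M \<nu>"
private abbreviation "\<tau>' \<equiv> slope' M \<nu>"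
private abbreviation "\<tau>'' \<equiv> slope'' M \<nu>"

text \<open>The first component of \<open>\<eta> w + \<eta>' v\<close>, with
  \<open>\<eta>' = - \<tau>\<close>. Since \<open>\<eta>\<close> is even and \<open>\<tau>\<close>
  odd, the second component is \<open>barrier (- x)\<close>, so one scalar function describes the
  pair.\<close>

definition "barrier x = \<eta> x * W x - \<tau> x * V x"
definition "barrier' x = \<eta> x * (V x * (V (- x))\<^sup>2) - 2 * \<tau> x * W x - \<tau>' x * V x"
definition "barrier'' x = - 3 * \<tau>' x * W x - 3 * \<tau> x * (V x * (V (- x))\<^sup>2)
  + \<eta> x * (W x * (V (- x))\<^sup>2 - 2 * V x * V (- x) * W (- x)) - \<tau>'' x * V x"

lemma DERIV_barrier: "(barrier has_real_derivative barrier' x) (at x)"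
  unfolding barrier_def[abs_def]
  by (rule DERIV_cong[OF DERIV_diff[OF DERIV_mult[OF DERIV_amp[OF M_pos nu(1)] DERIV_W]
        DERIV_mult[OF DERIV_slope[OF M_pos nu(1)] DERIV_V]]])
    (simp add: barrier'_def algebra_simps)

lemma DERIV_V_reflect: "((\<lambda>x. V (- x)) has_real_derivative - W (- x)) (at x)"
  using DERIV_mirror[of V "W (- x)" x] DERIV_V[of "- x"] by simp

lemma DERIV_barrier': "(barrier' has_real_derivative barrier'' x) (at x)"
  unfolding barrier'_def[abs_def]
  by (rule DERIV_cong[OF DERIV_diff[OF DERIV_diff[OF
        DERIV_mult[OF DERIV_amp[OF M_pos nu(1)]
          DERIV_mult[OF DERIV_V DERIV_power[OF DERIV_V_reflect]]]
        DERIV_mult[OF DERIV_cmult[OF DERIV_slope[OF M_pos nu(1)]] DERIV_W]]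
        DERIV_mult[OF DERIV_slope'[OF M_pos nu(1)] DERIV_V]]])
    (simp add: barrier''_def algebra_simps power2_eq_square)

text \<open>In vector form, \<open>w\<close> is in the kernel of \<open>L\<^sub>0\<close>,
  \<open>v' = w\<close> and \<open>L\<^sub>0 v = 2 w'\<close>. Hence the terms
  \<open>2 \<eta>' w'\<close> cancel and \<open>- 3 \<eta>'' w - \<eta>''' v\<close>
  remains.\<close>

lemma L_barrier:
  "- barrier'' x + (V (- x))\<^sup>2 * barrier x - 2 * V x * V (- x) * barrier (- x) = 3 * \<tau>' x * W x + \<tau>'' x * V x"
  by (simp add: barrier''_def barrier_def slope_minus[OF M_pos nu(1)] amp_minus[OF M_pos nu(1)]
      algebra_simps power2_eq_square)

lemma shifted_arctan_le:
  assumes "x \<ge> 0"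
  shows "(M + x) * s1 x \<le> 2 * s0 x + 2 * M"
proof -
  have "M * s1 x \<le> M * 2"
    using M_pos arctan_abs_less_2[of "x / M"] by (intro mult_left_mono) auto
  then show ?thesis using bend_ge[OF M_pos, of x] by (simp add: algebra_simps)
qed

text \<open>For \<open>x < 0\<close> both terms have the right sign. For \<open>x \<ge> 0\<close>,
  \<open>V x \<le> (M + x) * W x\<close> reduces the claim to
  \<open>(M + x) * s1 x \<le> 2 / \<nu> * (r x)\<^sup>2\<close>, which is
  \<open>shifted_arctan_le\<close> together with \<open>M \<le> 1 / \<nu>\<close>.\<close>

lemma barrier_nonneg: "barrier x \<ge> 0"
proof (cases "x \<ge> 0")
  case True
  have r: "r x \<ge> 1" by (rule rad_ge_1[OF M_pos nu(1)])
  have s1: "s1 x \<ge> 0" using True M_pos by simp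
  have "s1 x * V x \<le> s1 x * ((M + x) * W x)"
    using V_le_mult_W[OF True] s1 unfolding M_def by (intro mult_left_mono) auto
  also have "\<dots> = ((M + x) * s1 x) * W x" by simp
  also have "\<dots> \<le> (2 * s0 x + 2 / \<nu>) * W x"
  proof (intro mult_right_mono)
    have "M \<le> 1 / \<nu>" using nu by (simp add: field_simps)
    then show "(M + x) * s1 x \<le> 2 * s0 x + 2 / \<nu>"
      using shifted_arctan_le[OF True] by simp
  qed (use W_pos[of x] in simp)
  also have "\<dots> = 2 / \<nu> * (r x)\<^sup>2 * W x"
    using nu by (simp add: rad_squared[OF M_pos nu(1)] field_simps)
  finally have "s1 x * V x / r x ^ 3 \<le> 2 / \<nu> * (r x)\<^sup>2 * W x / r x ^ 3"
    using r by (intro divide_right_mono) auto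
  also have "\<dots> = \<eta> x * W x"
    using r by (simp add: amp_def[OF M_pos nu(1)] power2_eq_square power3_eq_cube)
  finally show ?thesis by (simp add: barrier_def slope_def[OF M_pos nu(1)])
next
  case False
  have r: "r x \<ge> 1" by (rule rad_ge_1[OF M_pos nu(1)])
  have "s1 x \<le> 0" using False M_pos by (simp add: divide_le_0_iff)
  then have "\<tau> x * V x \<le> 0"
    using r V_pos[of x] unfolding slope_def[OF M_pos nu(1)]
    by (intro mult_nonpos_nonneg) (auto simp: divide_le_0_iff)
  moreover have "\<eta> x * W x \<ge> 0"
    using r W_pos[of x] nu by (simp add: amp_def[OF M_pos nu(1)])
  ultimately show ?thesis by (simp add: barrier_def)
qed

text \<open>The height \<open>2 / \<nu>\<close> of \<open>\<eta>\<close> is the source of the factor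
  \<open>1 / \<omega>\<close>. The other term adds to the barrier only for \<open>x < 0\<close>,
  where \<open>V x \<le> 1\<close>.\<close>

lemma barrier_le:
  assumes "\<And>x. W x \<le> B"
  shows "barrier x \<le> 2 / \<nu> * B + 2"
proof -
  have r: "r x \<ge> 1" by (rule rad_ge_1[OF M_pos nu(1)])
  have "\<eta> x * W x \<le> 2 / \<nu> * B"
    unfolding amp_def[OF M_pos nu(1)] using r nu W_pos[of x] assms
    by (intro mult_mono) (auto simp: divide_simps)
  moreover have "- \<tau> x * V x \<le> 2"
  proof (cases "x \<ge> 0")
    case True
    then have "\<tau> x * V x \<ge> 0"
      using r M_pos V_pos[of x] by (simp add: slope_def[OF M_pos nu(1)])
    then show ?thesis by simp
  next
    case False
    have "1 / r x ^ 3 \<le> 1" using r by simp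
    then have "\<bar>s1 x\<bar> * (1 / r x ^ 3) \<le> 2 * 1"
      using arctan_abs_less_2[of "x / M"] r by (intro mult_mono) auto
    moreover have "\<bar>\<tau> x\<bar> = \<bar>s1 x\<bar> * (1 / r x ^ 3)"
      using r by (simp add: slope_def[OF M_pos nu(1)] abs_mult)
    moreover have "V x \<le> 1" using V_mono[of x 0] V_0 False by simp
    ultimately have "\<bar>\<tau> x\<bar> * V x \<le> 2 * 1" using V_pos[of x] by (intro mult_mono) auto
    moreover have "- \<tau> x * V x \<le> \<bar>\<tau> x\<bar> * V x"
      using V_pos[of x] by (intro mult_right_mono) auto
    ultimately show ?thesis by simp
  qed
  ultimately show ?thesis by (simp add: barrier_def)
qed

text \<open>The right-hand side is \<open>r ^ 3\<close> times \<open>L\<^sub>0\<close> of the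
  barrier plus \<open>36 * \<nu>\<^sup>2\<close> times the barrier. For \<open>x < 0\<close> the
  factor of \<open>V\<close> is nonnegative. For \<open>x \<ge> 0\<close> its negative part is paid
  for by the factor of \<open>W\<close>, and the constants balance: \<open>72 = 18 + 18 + 36\<close>
  and \<open>3 - 5 / 2 = 1 / 2\<close>.\<close>

lemma L_barrier_bracket:
  "W x * s2 x / 2 \<le> W x * (3 * s2 x - 9 / 2 * \<nu> * (s1 x)\<^sup>2 / (r x)\<^sup>2 + 72 * \<nu> * (r x)\<^sup>2)
    + V x * (s3 x - 9 / 2 * \<nu> * s1 x * s2 x / (r x)\<^sup>2 + 15 / 4 * \<nu>\<^sup>2 * s1 x ^ 3 / (r x) ^ 4
      - 36 * \<nu>\<^sup>2 * s1 x)" (is "_ \<le> W x * ?A + V x * ?B")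
proof -
  define D where "D = (r x)\<^sup>2"
  have D: "D = 1 + \<nu> * s0 x" "D \<ge> 1"
    using rad_squared[OF M_pos nu(1)] bend_nonneg[OF M_pos, of x] nu by (auto simp: D_def)
  have Q: "M\<^sup>2 + x\<^sup>2 > 0" using M_pos by (simp add: add_pos_nonneg)
  have s2: "s2 x > 0" using Q M_pos by simp
  have "(s1 x)\<^sup>2 \<le> 2\<^sup>2"
    using arctan_abs_less_2[of "x / M"] by (intro power2_le_iff_abs_le[THEN iffD2]) auto
  then have s1sq: "(s1 x)\<^sup>2 / D \<le> 4"
    using D(2) by (auto simp: divide_le_eq)
  then have "9 / 2 * \<nu> * ((s1 x)\<^sup>2 / D) \<le> 9 / 2 * \<nu> * 4"
    using nu by (intro mult_left_mono) auto
  then have A: "?A \<ge> 3 * s2 x - 18 * \<nu> + 72 * \<nu> * D" by (simp add: D_def)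
  have r4: "r x ^ 4 = D\<^sup>2" by (simp add: D_def)
  have W: "W x > 0" and V: "V x > 0" by (rule W_pos V_pos)+
  show ?thesis
  proof (cases "x \<ge> 0")
    case True
    define y where "y = M + x"
    have s1: "s1 x \<ge> 0" "s1 x \<le> 2"
      using True M_pos arctan_abs_less_2[of "x / M"] by auto
    have Vle: "V x \<le> y * W x" using V_le_mult_W[OF True] by (simp add: M_def y_def)
    \<comment> \<open>\<open>T\<close> collects the adverse terms of the factor of \<open>V\<close>,
      with \<open>D\<close> replaced by its lower bound 1. The three summands of \<open>U\<close>
      bound those of \<open>T\<close> times \<open>y\<close>, in the same order.\<close>
    define T where "T = - s3 x + 9 / 2 * \<nu> * s1 x * s2 x + 36 * \<nu>\<^sup>2 * s1 x"
    define U where "U = 5 / 2 * s2 x + 18 * \<nu> + (72 * \<nu>\<^sup>2 * s0 x + 36 * \<nu>)"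
    have neg: "T \<ge> 0"
      unfolding T_def using True M_pos s1 s2 nu Q by (intro add_nonneg_nonneg mult_nonneg_nonneg) auto
    have "9 / 2 * \<nu> * s1 x * s2 x / D \<le> 9 / 2 * \<nu> * s1 x * s2 x / 1"
      using D(2) s1 s2 nu by (intro divide_left_mono mult_nonneg_nonneg) auto
    moreover have "15 / 4 * \<nu>\<^sup>2 * s1 x ^ 3 / (r x) ^ 4 \<ge> 0" using s1 by simp
    ultimately have "?B \<ge> - T"
      unfolding T_def D_def[symmetric] div_by_1 by linarith
    then have "V x * - T \<le> V x * ?B"
      using V by (intro mult_left_mono) auto
    then have B: "- (V x * T) \<le> V x * ?B" by simp
    have VT: "V x * T \<le> y * W x * T"
      using Vle neg by (rule mult_right_mono)
    have "y * T \<le> U"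
    proof -
      \<comment> \<open>The difference of the two sides of the next inequality, written as a sum of
        squares.\<close>
      have "0 \<le> 2 * (M - x / 2)\<^sup>2 + M\<^sup>2 / 2" by simp
      then have "2 * x * y \<le> 5 / 2 * (M\<^sup>2 + x\<^sup>2)"
        by (simp add: y_def power2_eq_square algebra_simps)
      then have "M * (2 * x * y) / (M\<^sup>2 + x\<^sup>2)\<^sup>2 \<le> M * (5 / 2 * (M\<^sup>2 + x\<^sup>2)) / (M\<^sup>2 + x\<^sup>2)\<^sup>2"
        using M_pos by (intro divide_right_mono mult_left_mono) auto
      moreover have "M * (5 / 2 * q) / q\<^sup>2 = 5 / 2 * (M / q)" if "q > 0" for q :: real
        using that by (simp add: power2_eq_square)
      moreover have "y * - s3 x = M * (2 * x * y) / (M\<^sup>2 + x\<^sup>2)\<^sup>2" by simp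
      ultimately have a: "y * - s3 x \<le> 5 / 2 * s2 x" using Q by metis
      have "0 \<le> (M - x / 2)\<^sup>2 + 7 / 4 * x\<^sup>2" by simp
      then have "y * s2 x \<le> 2"
        using Q by (simp add: y_def power2_eq_square algebra_simps pos_divide_le_eq)
      then have "(s1 x) * (y * s2 x) \<le> 2 * 2"
        using s1 s2 True M_pos by (intro mult_mono) (auto simp: y_def)
      then have "9 / 2 * \<nu> * ((s1 x) * (y * s2 x)) \<le> 9 / 2 * \<nu> * (2 * 2)"
        using nu by (intro mult_left_mono) auto
      then have b: "y * (9 / 2 * \<nu> * s1 x * s2 x) \<le> 18 * \<nu>" by (simp add: mult_ac)
      have "36 * \<nu>\<^sup>2 * (y * s1 x) \<le> 36 * \<nu>\<^sup>2 * (2 * s0 x + 2 * M)"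
        using shifted_arctan_le[OF True] by (intro mult_left_mono) (auto simp: y_def)
      also have "\<dots> = 72 * \<nu>\<^sup>2 * s0 x + 72 * \<nu> * (\<nu> * M)"
        by (simp add: algebra_simps power2_eq_square)
      also have "\<dots> \<le> 72 * \<nu>\<^sup>2 * s0 x + 72 * \<nu> * (1 / 2)"
        using nu by (intro add_left_mono mult_left_mono) auto
      finally have c: "y * (36 * \<nu>\<^sup>2 * s1 x) \<le> 72 * \<nu>\<^sup>2 * s0 x + 36 * \<nu>" by (simp add: mult_ac)
      show ?thesis unfolding T_def U_def distrib_left using a b c by linarith
    qed
    then have "W x * (y * T) \<le> W x * U"
      using W by (intro mult_left_mono) auto
    with VT have "V x * T \<le> W x * U" by (simp add: mult_ac)
    moreover have "W x * (3 * s2 x - 18 * \<nu> + 72 * \<nu> * D) \<le> W x * ?A"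
      using A W by (intro mult_left_mono) auto
    moreover have "W x * s2 x / 2 = W x * (3 * s2 x - 18 * \<nu> + 72 * \<nu> * D) - W x * U"
    proof -
      have "b / 2 = (3 * b - 18 * \<nu> + 72 * \<nu> * (1 + \<nu> * a))
          - (5 / 2 * b + 18 * \<nu> + (72 * \<nu>\<^sup>2 * a + 36 * \<nu>))" for a b :: real
        by (simp add: algebra_simps power2_eq_square)
      then have "s2 x / 2 = (3 * s2 x - 18 * \<nu> + 72 * \<nu> * D) - U"
        unfolding D(1) U_def .
      then show ?thesis by (metis right_diff_distrib times_divide_eq_right)
    qed
    ultimately show ?thesis using B by argo
  next
    case False
    have s1: "s1 x \<le> 0" using False M_pos by (simp add: divide_le_0_iff)
    have "72 * \<nu> * 1 \<le> 72 * \<nu> * D" using D(2) nu by (intro mult_left_mono) auto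
    then have "b / 2 \<le> 3 * b - 18 * \<nu> + 72 * \<nu> * D" if "b > 0" for b
      using that nu(1) by linarith
    from this[OF s2] A have "?A \<ge> s2 x / 2" by (rule order.trans)
    then have "W x * ?A \<ge> W x * (s2 x / 2)" using W by (intro mult_left_mono) auto
    moreover have "?B \<ge> 0"
    proof -
      have "s3 x \<ge> 0" using False M_pos by (intro divide_nonneg_nonneg) (auto simp: mult_le_0_iff)
      moreover have "9 / 2 * \<nu> * s1 x * s2 x / D \<le> 0"
      proof -
        have "9 / 2 * \<nu> * a * b / D \<le> 0" if "a \<le> 0" "b > 0" for a b
          using that nu D(2)
          by (intro divide_nonpos_pos mult_nonpos_nonneg mult_nonneg_nonpos) auto
        from this[OF s1 s2] show ?thesis .
      qed
      \<comment> \<open>Both sides are nonpositive here; the left one is smaller in size because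
        \<open>15 / 4 * 4 \<le> 36\<close>.\<close>
      moreover have "15 / 4 * \<nu>\<^sup>2 * s1 x ^ 3 / D\<^sup>2 \<ge> 36 * \<nu>\<^sup>2 * s1 x"
      proof -
        have "(s1 x)\<^sup>2 / D / D \<le> 4 / D" using s1sq D(2) by (intro divide_right_mono) auto
        also have "\<dots> \<le> 4" using D(2) by (simp add: divide_le_eq)
        finally have "15 / 4 * ((s1 x)\<^sup>2 / D / D) \<le> 36" by simp
        then have "(\<nu>\<^sup>2 * s1 x) * 36 \<le> (\<nu>\<^sup>2 * s1 x) * (15 / 4 * ((s1 x)\<^sup>2 / D / D))"
          using s1 by (intro mult_left_mono_neg) (auto simp: mult_nonneg_nonpos)
        then show ?thesis by (simp add: power2_eq_square power3_eq_cube mult_ac)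
      qed
      ultimately show ?thesis unfolding r4 D_def[symmetric] by linarith
    qed
    ultimately show ?thesis using V by (simp add: add_increasing2)
  qed
qed

text \<open>For \<open>\<omega>\<^sup>2 = 36 * \<nu>\<^sup>2\<close> the right-hand side is the
  first component of \<open>L\<^sub>\<omega>\<close> on the barrier pair. Bounding
  \<open>r ^ 3\<close> by \<open>(1 + \<bar>x\<bar>)\<^sup>2\<close> removes \<open>\<nu>\<close>
  from the lower bound, so one constant \<open>K\<close> can serve all small
  \<open>\<omega>\<close>.\<close>

lemma L_barrier_lower:
  "W x * M / (2 * ((M\<^sup>2 + x\<^sup>2) * (1 + \<bar>x\<bar>)\<^sup>2))
    \<le> 3 * \<tau>' x * W x + \<tau>'' x * V x + 36 * \<nu>\<^sup>2 * barrier x"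
proof -
  have alg: "3 * (b / r ^ 3 - 3 / 2 * \<nu> * a\<^sup>2 / r ^ 5) * w
      + (c / r ^ 3 - 9 / 2 * \<nu> * a * b / r ^ 5 + 15 / 4 * \<nu>\<^sup>2 * a ^ 3 / r ^ 7) * v
      + 36 * \<nu>\<^sup>2 * (2 / \<nu> * (1 / r ^ 1) * w - a * (1 / r ^ 3) * v)
    = (w * (3 * b - 9 / 2 * \<nu> * a\<^sup>2 / r\<^sup>2 + 72 * \<nu> * r\<^sup>2)
        + v * (c - 9 / 2 * \<nu> * a * b / r\<^sup>2 + 15 / 4 * \<nu>\<^sup>2 * a ^ 3 / r ^ 4 - 36 * \<nu>\<^sup>2 * a)) / r ^ 3"
    if "r > 0" for a b c r v w :: real
  proof -
    have pow: "r ^ 5 = r\<^sup>2 * r ^ 3" "r ^ 7 = r ^ 4 * r ^ 3" by (simp_all flip: power_add)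
    have "36 * \<nu>\<^sup>2 * (2 / \<nu> * (1 / r ^ 1) * w) = w * (72 * \<nu> * r\<^sup>2) / r ^ 3"
      using that nu(1) by (simp add: power2_eq_square power3_eq_cube)
    then show ?thesis
      unfolding pow by (simp add: add_divide_distrib diff_divide_distrib ring_distribs mult_ac)
  qed
  have r: "r x \<ge> 1" by (rule rad_ge_1[OF M_pos nu(1)])
  have Q: "M\<^sup>2 + x\<^sup>2 > 0" using M_pos by (simp add: add_pos_nonneg)
  have "\<nu> * s0 x \<le> 1 / 2 * (2 * \<bar>x\<bar>)"
    using nu bend_le[OF M_pos, of x] bend_nonneg[OF M_pos, of x] by (intro mult_mono) auto
  then have "(r x)\<^sup>2 \<le> 1 + \<bar>x\<bar>" by (simp add: rad_squared[OF M_pos nu(1)])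
  then have "((r x)\<^sup>2)\<^sup>2 \<le> (1 + \<bar>x\<bar>)\<^sup>2" by (intro power_mono) auto
  moreover have "r x ^ 3 \<le> r x ^ 4" using r by (intro power_increasing) auto
  ultimately have r3: "r x ^ 3 \<le> (1 + \<bar>x\<bar>)\<^sup>2" by simp
  have "W x * M / (2 * ((M\<^sup>2 + x\<^sup>2) * (1 + \<bar>x\<bar>)\<^sup>2)) = W x * s2 x / 2 / (1 + \<bar>x\<bar>)\<^sup>2"
    by simp
  also have "\<dots> \<le> W x * s2 x / 2 / r x ^ 3"
    using r3 r W_pos[of x] M_pos Q by (intro divide_left_mono mult_pos_pos) auto
  also have "\<dots> \<le> (W x * (3 * s2 x - 9 / 2 * \<nu> * (s1 x)\<^sup>2 / (r x)\<^sup>2 + 72 * \<nu> * (r x)\<^sup>2)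
    + V x * (s3 x - 9 / 2 * \<nu> * s1 x * s2 x / (r x)\<^sup>2 + 15 / 4 * \<nu>\<^sup>2 * s1 x ^ 3 / (r x) ^ 4
      - 36 * \<nu>\<^sup>2 * s1 x)) / r x ^ 3"
    using r by (intro divide_right_mono L_barrier_bracket) auto
  also have "\<dots> = 3 * \<tau>' x * W x + \<tau>'' x * V x + 36 * \<nu>\<^sup>2 * barrier x"
    unfolding barrier_def slope_def[OF M_pos nu(1)] slope'_def[OF M_pos nu(1)]
      slope''_def[OF M_pos nu(1)] amp_def[OF M_pos nu(1)]
    using r by (intro alg[symmetric]) auto
  finally show ?thesis .
qed

end

text \<open>The numerator is what adding \<open>1 / cosh (\<theta> * x)\<close> costs:
  \<open>1\<close> is the target, \<open>\<theta>\<^sup>2\<close> bounds the second derivative, the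
  rest is the potential. For \<open>x \<ge> 0\<close> the exponential decay beats polynomials; on
  \<open>[-X, 0)\<close> all quantities are bounded suitably; for \<open>x < - X\<close>, where
  \<open>W\<close> has no useful lower bound, the numerator is nonpositive.\<close>

lemma barrier_dominates_sech:
  assumes \<theta>: "\<theta> > 0"
  shows "\<exists>K>0. \<forall>x. (1 + \<theta>\<^sup>2 + 2 * V x * V (- x) - (V (- x))\<^sup>2) / cosh (\<theta> * x)
    \<le> K * (W x * M / (2 * ((M\<^sup>2 + x\<^sup>2) * (1 + \<bar>x\<bar>)\<^sup>2)))"
proof -
  obtain C where C: "\<And>x. x \<ge> 0 \<Longrightarrow> V x \<le> C * (1 + x)" using V_linear by blast
  have C0: "C > 0" using C[of 0] V_0 by simp
  \<comment> \<open>So \<open>X * W 0 = 2 + \<theta>\<^sup>2\<close>, and the tangent at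
    \<open>0\<close> gives \<open>V (- x) \<ge> 3 + \<theta>\<^sup>2\<close> for
    \<open>x < - X\<close>.\<close>
  define X where "X = (2 + \<theta>\<^sup>2) * M"
  have X0: "X > 0" using M_pos by (simp add: X_def add_pos_nonneg)
  define q where "q x = 2 * ((M\<^sup>2 + x\<^sup>2) * (1 + \<bar>x\<bar>)\<^sup>2)" for x
  have q: "q x > 0" for x
    using M_pos unfolding q_def by (intro mult_pos_pos add_pos_nonneg zero_less_power) auto
  define c where "c = 2 * (1 + \<theta>\<^sup>2 + 2 * C) * (M\<^sup>2 + 1)"
  have c: "c > 0" unfolding c_def using C0 by (intro mult_pos_pos add_nonneg_pos) auto
  \<comment> \<open>On the right half-line the numerator times \<open>q\<close> is at most
    \<open>c * (1 + x) ^ 5\<close>. Here \<open>240 = 2 * fact 5\<close>, the 2 coming from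
    \<open>exp \<le> 2 * cosh\<close> and \<open>exp \<theta>\<close> from the shift
    \<open>1 + x\<close>.\<close>
  define K1 where "K1 = c * (240 * exp \<theta> / \<theta> ^ 5)"
  define K2 where "K2 = (2 + \<theta>\<^sup>2) * q X / (W (- X) * M)"
  have "K1 > 0" using c \<theta> by (simp add: K1_def)
  moreover have "(1 + \<theta>\<^sup>2 + 2 * V x * V (- x) - (V (- x))\<^sup>2) / cosh (\<theta> * x)
    \<le> max K1 K2 * (W x * M / q x)" for x
  proof -
    define N where "N = 1 + \<theta>\<^sup>2 + 2 * V x * V (- x) - (V (- x))\<^sup>2"
    have WM: "W x * M / q x > 0" using W_pos M_pos q by simp
    have ch: "cosh (\<theta> * x) \<ge> 1" by (rule cosh_real_ge_1)
    consider "x \<ge> 0" | "- X \<le> x" "x < 0" | "x < - X" by linarith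
    then have "N / cosh (\<theta> * x) \<le> max K1 K2 * (W x * M / q x)"
    proof cases
      case 1
      have "V (- x) \<le> 1" using V_mono[of "- x" 0] 1 V_0 by simp
      then have "V x * V (- x) \<le> V x * 1" using V_pos[of x] by (intro mult_left_mono) auto
      then have "N \<le> (1 + \<theta>\<^sup>2) * 1 + 2 * (C * (1 + x))"
      proof -
        have "1 + t + 2 * p - q \<le> (1 + t) * 1 + 2 * w" if "p \<le> v * 1" "v \<le> w" "0 \<le> q"
          for p q t v w :: real
          using that by simp
        then show ?thesis
          using \<open>V x * V (- x) \<le> V x * 1\<close> C[OF 1] zero_le_power2[of "V (- x)"]
          unfolding N_def mult.assoc by blast
      qed
      also have "\<dots> \<le> (1 + \<theta>\<^sup>2) * (1 + x) + 2 * (C * (1 + x))"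
        using 1 by (intro add_right_mono mult_left_mono) auto
      finally have N: "N \<le> (1 + \<theta>\<^sup>2 + 2 * C) * (1 + x)" by (simp add: algebra_simps)
      have "0 \<le> M\<^sup>2 * (2 * x + x\<^sup>2) + (1 + 2 * x)" using 1 by simp
      then have "M\<^sup>2 + x\<^sup>2 \<le> (M\<^sup>2 + 1) * (1 + x)\<^sup>2"
        by (simp add: algebra_simps power2_eq_square)
      then have "q x \<le> 2 * (((M\<^sup>2 + 1) * (1 + x)\<^sup>2) * (1 + x)\<^sup>2)"
        using 1 unfolding q_def by (intro mult_left_mono mult_right_mono) auto
      then have "N * q x \<le> ((1 + \<theta>\<^sup>2 + 2 * C) * (1 + x)) * (2 * (((M\<^sup>2 + 1) * (1 + x)\<^sup>2) * (1 + x)\<^sup>2))"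
        using N q[of x] C0 1 by (intro mult_mono) (auto intro!: mult_nonneg_nonneg)
      also have "\<dots> = c * (1 + x) ^ 5"
      proof -
        have "(a * u) * (2 * ((b * u\<^sup>2) * u\<^sup>2)) = 2 * a * b * u ^ 5" for a b u :: real
          by (simp add: eval_nat_numeral mult_ac)
        then show ?thesis unfolding c_def .
      qed
      also have "\<dots> \<le> c * (240 * exp \<theta> / \<theta> ^ 5 * cosh (\<theta> * x))"
      proof (intro mult_left_mono)
        have "(\<theta> * (1 + x)) ^ 5 / fact 5 \<le> exp (\<theta> * (1 + x))"
          using \<theta> 1 by (intro power_div_fact_le_exp) auto
        also have "\<dots> \<le> exp \<theta> * (2 * cosh (\<theta> * x))"
          by (simp add: exp_add distrib_left cosh_def)
        finally have "(1 + x) ^ 5 * \<theta> ^ 5 \<le> 240 * exp \<theta> * cosh (\<theta> * x)"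
          by (simp add: power_mult_distrib fact_numeral mult_ac)
        then show "(1 + x) ^ 5 \<le> 240 * exp \<theta> / \<theta> ^ 5 * cosh (\<theta> * x)"
          using \<theta> by (simp add: pos_le_divide_eq)
      qed (use c in simp)
      finally have "N * q x \<le> K1 * cosh (\<theta> * x)" by (simp add: K1_def)
      then have "N / cosh (\<theta> * x) \<le> K1 * (1 / q x)"
        using q[of x] ch by (simp add: field_simps)
      also have "\<dots> \<le> max K1 K2 * (W x * M / q x)"
      proof (intro mult_mono divide_right_mono)
        show "1 \<le> W x * M" using W_mono[OF 1] W_pos[of 0] by (simp add: M_def)
      qed (use q[of x] \<open>K1 > 0\<close> in auto)
      finally show ?thesis .
    next
      case 2
      have "V x \<le> 1" using V_mono[of x 0] 2 V_0 by simp
      then have "V x * V (- x) \<le> 1 * V (- x)" using V_pos[of "- x"] by (intro mult_right_mono) auto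
      moreover have "0 \<le> (V (- x) - 1)\<^sup>2" by simp
      ultimately have N: "N \<le> 2 + \<theta>\<^sup>2" by (simp add: N_def power2_eq_square algebra_simps)
      have qX: "q x \<le> q X"
        unfolding q_def using 2 X0
        by (intro mult_left_mono mult_mono add_left_mono power_mono power2_le_iff_abs_le[THEN iffD2]) auto
      have WX: "W (- X) * M \<le> W x * M" using W_mono[OF 2(1)] M_pos by simp
      have WX0: "W (- X) * M > 0" using W_pos M_pos by simp
      have "N / cosh (\<theta> * x) \<le> (2 + \<theta>\<^sup>2) / 1"
        using N ch by (intro frac_le) auto
      also have "\<dots> = K2 * (W (- X) * M / q X)"
        using WX0 q[of X] W_pos[of "- X"] M_pos by (simp add: K2_def)
      also have "\<dots> \<le> max K1 K2 * (W x * M / q x)"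
        by (rule mult_mono[OF max.cobounded2 frac_le[OF _ WX q qX]])
          (use WX WX0 q[of X] \<open>K1 > 0\<close> W_pos[of x] W_pos[of "- X"] M_pos in \<open>auto intro: less_imp_le\<close>)
      finally show ?thesis .
    next
      case 3
      have "V x \<le> 1" using V_mono[of x 0] 3 X0 V_0 by simp
      then have "V x * V (- x) \<le> 1 * V (- x)" using V_pos[of "- x"] by (intro mult_right_mono) auto
      then have "N \<le> 1 + \<theta>\<^sup>2 - V (- x) * (V (- x) - 2)"
        by (simp add: N_def power2_eq_square algebra_simps)
      moreover have "V (- x) \<ge> 3 + \<theta>\<^sup>2"
      proof -
        have "X * W 0 \<le> - x * W 0" using 3 W_pos[of 0] by (intro mult_right_mono) auto
        moreover have "X * W 0 = 2 + \<theta>\<^sup>2" using W_pos[of 0] by (simp add: X_def M_def)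
        ultimately show ?thesis using V_secant(1)[of 0 "- x"] 3 X0 V_0 by simp
      qed
      then have "(3 + \<theta>\<^sup>2) * (1 + \<theta>\<^sup>2) \<le> V (- x) * (V (- x) - 2)"
        using V_pos[of "- x"] by (intro mult_mono) auto
      moreover have "1 * (1 + \<theta>\<^sup>2) \<le> (3 + \<theta>\<^sup>2) * (1 + \<theta>\<^sup>2)"
        by (intro mult_right_mono) auto
      ultimately have "N \<le> 0" by simp
      then have "N / cosh (\<theta> * x) \<le> 0" using ch by (simp add: divide_le_0_iff)
      also have "0 \<le> max K1 K2 * (W x * M / q x)"
        using WM \<open>K1 > 0\<close> by (intro mult_nonneg_nonneg) auto
      finally show ?thesis .
    qed
    then show ?thesis by (simp add: N_def)
  qed
  ultimately show ?thesis unfolding q_def by (intro exI[of _ "max K1 K2"]) auto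
qed

section \<open>The supersolution and the estimate\<close>

text \<open>The pair is \<open>S\<close> and its reflection, with \<open>S\<close> equal to
  \<open>K\<close> times the barrier plus \<open>1 / cosh (\<theta> * x)\<close>; the inequality for
  the second component is the stated one at \<open>- x\<close>.\<close>

lemma strict_supersolution:
  assumes \<theta>: "\<theta> > 0"
  shows "\<exists>C \<omega>0. C > 0 \<and> \<omega>0 > 0 \<and> (\<forall>\<omega>\<in>{0<..<\<omega>0}. \<exists>S S' S''.
    (\<forall>x. (S has_real_derivative S' x) (at x)) \<and> (\<forall>x. (S' has_real_derivative S'' x) (at x)) \<and>
    (\<forall>x. 0 < S x \<and> S x \<le> C / \<omega>) \<and>
    (\<forall>x. 1 / cosh (\<theta> * x) \<le> - S'' x + ((V (- x))\<^sup>2 + \<omega>\<^sup>2) * S x - 2 * V x * V (- x) * S (- x)))"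
proof -
  obtain K where K: "K > 0"
    "\<And>x. (1 + \<theta>\<^sup>2 + 2 * V x * V (- x) - (V (- x))\<^sup>2) / cosh (\<theta> * x)
      \<le> K * (W x * M / (2 * ((M\<^sup>2 + x\<^sup>2) * (1 + \<bar>x\<bar>)\<^sup>2)))"
    using barrier_dominates_sech[OF \<theta>] by blast
  obtain B where B: "\<And>x. W x \<le> B" using W_bounded by blast
  have B0: "B > 0" using B[of 0] W_pos[of 0] by simp
  define C where "C = K * (12 * B + 2) + 1"
  have C0: "C > 0" using K B0 by (simp add: C_def add_pos_pos)
  \<comment> \<open>The bound \<open>3 / M\<close> ensures \<open>\<nu> * M \<le> 1 / 2\<close>; the
    bound \<open>1\<close> lets constants be absorbed into multiples of
    \<open>1 / \<omega>\<close>.\<close>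
  define \<omega>0 where "\<omega>0 = min 1 (3 / M)"
  have "\<omega>0 > 0" using M_pos by (simp add: \<omega>0_def)
  moreover have "\<exists>S S' S''.
    (\<forall>x. (S has_real_derivative S' x) (at x)) \<and> (\<forall>x. (S' has_real_derivative S'' x) (at x)) \<and>
    (\<forall>x. 0 < S x \<and> S x \<le> C / \<omega>) \<and>
    (\<forall>x. 1 / cosh (\<theta> * x) \<le> - S'' x + ((V (- x))\<^sup>2 + \<omega>\<^sup>2) * S x - 2 * V x * V (- x) * S (- x))"
    if "\<omega> \<in> {0<..<\<omega>0}" for \<omega>
  proof -
    define \<nu> where "\<nu> = \<omega> / 6"
    have \<omega>: "0 < \<omega>" "\<omega> < 1" "\<omega> < 3 / M" using that by (auto simp: \<omega>0_def)
    have nu: "\<nu> > 0" "\<nu> \<le> 1 / 2" "\<nu> * M \<le> 1 / 2"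
      using \<omega> M_pos by (auto simp: \<nu>_def field_simps)
    have \<omega>2: "36 * \<nu>\<^sup>2 = \<omega>\<^sup>2" by (simp add: \<nu>_def power_divide)
    define E where "E x = 1 / cosh (\<theta> * x)" for x
    define E' where "E' x = - \<theta> * sinh (\<theta> * x) / (cosh (\<theta> * x))\<^sup>2" for x
    define E'' where "E'' x = \<theta>\<^sup>2 * (2 * (sinh (\<theta> * x))\<^sup>2 / cosh (\<theta> * x) ^ 3 - 1 / cosh (\<theta> * x))" for x
    have ch: "cosh (\<theta> * x) > 0" for x by simp
    have dE: "(E has_real_derivative E' x) (at x)" for x
      unfolding E_def[abs_def] E'_def using ch[of x]
      by (auto intro!: derivative_eq_intros simp: power2_eq_square)
    have dE': "(E' has_real_derivative E'' x) (at x)" for x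
    proof -
      have "((\<lambda>x. - \<theta> * sinh (\<theta> * x) / (cosh (\<theta> * x))\<^sup>2) has_real_derivative
        (- \<theta> * (cosh (\<theta> * x) * \<theta>) * (cosh (\<theta> * x))\<^sup>2
          - (- \<theta> * sinh (\<theta> * x)) * (2 * cosh (\<theta> * x) * (sinh (\<theta> * x) * \<theta>)))
        / ((cosh (\<theta> * x))\<^sup>2 * (cosh (\<theta> * x))\<^sup>2)) (at x)"
        using ch[of x] by (auto intro!: derivative_eq_intros) (simp add: divide_simps algebra_simps)
      also have "(- \<theta> * (c * \<theta>) * c\<^sup>2 - (- \<theta> * t) * (2 * c * (t * \<theta>))) / (c\<^sup>2 * c\<^sup>2)
        = \<theta>\<^sup>2 * (2 * t\<^sup>2 / c ^ 3 - 1 / c)" if "c > 0" for c t :: real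
        using that by (simp add: divide_simps) (simp add: eval_nat_numeral algebra_simps)
      from this[OF ch[of x]] show ?thesis
        using calculation unfolding E'_def[abs_def] E''_def by simp
    qed
    have E'': "E'' x \<le> \<theta>\<^sup>2 * E x" for x
    proof -
      have "(sinh (\<theta> * x))\<^sup>2 \<le> (cosh (\<theta> * x))\<^sup>2" by (simp add: cosh_square_eq)
      then have "2 * (sinh (\<theta> * x))\<^sup>2 / cosh (\<theta> * x) ^ 3 \<le> 2 * (cosh (\<theta> * x))\<^sup>2 / cosh (\<theta> * x) ^ 3"
        by (intro divide_right_mono) auto
      also have "\<dots> = 2 / cosh (\<theta> * x)" by (simp add: power2_eq_square power3_eq_cube)
      finally show ?thesis unfolding E''_def E_def by (intro mult_left_mono) auto
    qed
    have E: "0 < E x" "E x \<le> 1" "E (- x) = E x" for x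
      using cosh_real_ge_1[of "\<theta> * x"] by (auto simp: E_def)
    define S where "S x = K * barrier \<nu> x + E x" for x
    define S' where "S' x = K * barrier' \<nu> x + E' x" for x
    define S'' where "S'' x = K * barrier'' \<nu> x + E'' x" for x
    have "(S has_real_derivative S' x) (at x)" "(S' has_real_derivative S'' x) (at x)" for x
      unfolding S_def[abs_def] S'_def[abs_def] S''_def
      by (intro DERIV_add DERIV_cmult DERIV_barrier[OF nu] DERIV_barrier'[OF nu] dE dE')+
    moreover have "0 < S x" for x
      unfolding S_def using K(1) E(1)[of x] barrier_nonneg[OF nu, of x]
      by (intro add_nonneg_pos mult_nonneg_nonneg) auto
    moreover have "S x \<le> C / \<omega>" for x
    proof -
      have "K * barrier \<nu> x \<le> K * (2 / \<nu> * B + 2)"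
        using K(1) by (intro mult_left_mono barrier_le[OF nu B]) auto
      then have "S x \<le> K * (12 * B / \<omega> + 2) + 1" using E(2)[of x] by (simp add: S_def \<nu>_def)
      also have "\<dots> \<le> K * (12 * B / \<omega> + 2 / \<omega>) + 1 / \<omega>"
        using \<omega> K(1) by (intro add_mono mult_left_mono) (auto simp: divide_simps)
      also have "\<dots> = C / \<omega>" by (simp add: C_def add_divide_distrib distrib_left)
      finally show ?thesis .
    qed
    moreover have "1 / cosh (\<theta> * x)
      \<le> - S'' x + ((V (- x))\<^sup>2 + \<omega>\<^sup>2) * S x - 2 * V x * V (- x) * S (- x)" for x
    proof -
      define Lb where "Lb = - barrier'' \<nu> x + (V (- x))\<^sup>2 * barrier \<nu> x
        - 2 * V x * V (- x) * barrier \<nu> (- x) + \<omega>\<^sup>2 * barrier \<nu> x"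
      have "- S'' x + ((V (- x))\<^sup>2 + \<omega>\<^sup>2) * S x - 2 * V x * V (- x) * S (- x)
        = K * Lb + (- E'' x + ((V (- x))\<^sup>2 - 2 * V x * V (- x)) * E x + \<omega>\<^sup>2 * E x)"
        by (simp add: S_def S''_def Lb_def E(3) algebra_simps)
      moreover have "K * Lb \<ge> (1 + \<theta>\<^sup>2 + 2 * V x * V (- x) - (V (- x))\<^sup>2) / cosh (\<theta> * x)"
        using L_barrier_lower[OF nu, of x] L_barrier[OF nu, of x] K(1)
        by (intro order.trans[OF K(2)] mult_left_mono) (auto simp: Lb_def \<omega>2)
      moreover have "(1 + \<theta>\<^sup>2 + 2 * V x * V (- x) - (V (- x))\<^sup>2) / cosh (\<theta> * x)
        = E x + \<theta>\<^sup>2 * E x - ((V (- x))\<^sup>2 - 2 * V x * V (- x)) * E x"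
        by (simp add: E_def add_divide_distrib diff_divide_distrib)
      moreover have "\<omega>\<^sup>2 * E x \<ge> 0" using E(1)[of x] by simp
      ultimately show ?thesis using E''[of x] unfolding E_def[symmetric] by linarith
    qed
    ultimately show ?thesis by blast
  qed
  ultimately show ?thesis using C0 by blast
qed

end

section \<open>From the given profile to the norm estimate\<close>

lemma increasing_profile_if_entire:
  assumes "entire_profile V1 V2"
  shows "increasing_profile V1 (deriv V1)"
proof
  have C2: "\<And>x. V1 field_differentiable at x" "\<And>x. deriv V1 field_differentiable at x"
    and pos: "\<And>x. V1 x > 0" and d: "\<And>x. deriv V1 x > 0" and V0: "V1 0 = 1"
    and eq: "\<And>x. - deriv (deriv V1) x + V1 x * (V2 x)\<^sup>2 = 0" and refl: "\<And>x. V1 (- x) = V2 x"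
    using assms by (auto simp: entire_profile_def C2_on_def)
  show der: "(V1 has_real_derivative deriv V1 x) (at x)" for x
    using C2(1) by (simp add: DERIV_deriv_iff_field_differentiable)
  have "deriv (deriv V1) x = V1 x * (V1 (- x))\<^sup>2" for x using eq[of x] refl[of x] by simp
  then show "(deriv V1 has_real_derivative V1 x * (V1 (- x))\<^sup>2) (at x)" for x
    using C2(2)[of x] by (metis DERIV_deriv_iff_field_differentiable)
  show "V1 x > 0" "deriv V1 x > 0" for x using pos d by auto
  show "V1 0 = 1" by (rule V0)
  obtain A B c where A: "A > 0" "c > 0"
    "(\<lambda>x. V1 x - (A * x + B)) \<in> O[at_top](\<lambda>x. exp (- c * x\<^sup>2))"
    using assms unfolding entire_profile_def by blast
  then obtain b where b: "b > 0" "\<forall>\<^sub>F x in at_top. norm (V1 x - (A * x + B)) \<le> b * norm (exp (- c * x\<^sup>2))"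
    by (elim landau_o.bigE) blast
  then obtain N where N: "\<And>x. x \<ge> N \<Longrightarrow> \<bar>V1 x - (A * x + B)\<bar> \<le> b * exp (- c * x\<^sup>2)"
    by (auto simp: eventually_at_top_linorder)
  have V1_mono: "V1 x \<le> V1 y" if "x \<le> y" for x y
    by (rule DERIV_nonneg_imp_nondecreasing[OF that]) (use der d less_imp_le in meson)
  \<comment> \<open>The first three terms handle \<open>x \<ge> N\<close> through the asymptotics,
    the last one \<open>x < N\<close> through monotonicity.\<close>
  define C where "C = A + \<bar>B\<bar> + b + V1 N"
  have "V1 x \<le> C * (1 + x)" if "x \<ge> 0" for x
  proof -
    have C: "V1 N \<le> C" "A + \<bar>B\<bar> + b \<le> C" "C \<ge> 0" using A b pos[of N] by (auto simp: C_def)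
    have Cx: "C * 1 \<le> C * (1 + x)" using that C by (intro mult_left_mono) auto
    show ?thesis
    proof (cases "x \<ge> N")
      case True
      have "b * exp (- c * x\<^sup>2) \<le> b * 1" using A b by (intro mult_left_mono) auto
      then have "V1 x \<le> A * x + \<bar>B\<bar> + b" using N[OF True] by linarith
      also have "\<dots> \<le> (A + \<bar>B\<bar> + b) * (1 + x)" using that A b by (simp add: algebra_simps)
      also have "\<dots> \<le> C * (1 + x)" using that C by (intro mult_right_mono) auto
      finally show ?thesis .
    next
      case False
      then show ?thesis using V1_mono[of x N] C Cx by simp
    qed
  qed
  then show "\<exists>C. \<forall>x\<ge>0. V1 x \<le> C * (1 + x)" by blast
qed

theorem theorem1p1:
  fixes V1 V2 :: "real \<Rightarrow> real" and \<theta> :: real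
  assumes "entire_profile V1 V2"
    and "\<theta> > 0"
  shows "\<exists>C R0 \<omega>0 P0 :: real. C > 0 \<and> R0 > 0 \<and> \<omega>0 > 0 \<and> P0 > 0 \<and>
    (\<forall>R \<omega> \<phi>1 \<phi>2 g1 g2.
       R > R0 \<and> \<omega> \<in> {0<..<\<omega>0} \<and> \<omega> * R > P0 \<and>
       dirichlet_solution V1 V2 R \<omega> \<phi>1 \<phi>2 g1 g2 \<longrightarrow>
       C0_norm R \<phi>1 \<phi>2 \<le> ennreal (C * inverse \<omega>) * C0_weighted_norm \<theta> R g1 g2)"
proof -
  interpret increasing_profile V1 "deriv V1"
    by (rule increasing_profile_if_entire[OF assms(1)])
  have V2: "V2 x = V1 (- x)" for x using assms(1) by (simp add: entire_profile_def)
  obtain C \<omega>0 where C: "C > 0" "\<omega>0 > 0"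
    and sup: "\<And>\<omega>. \<omega> \<in> {0<..<\<omega>0} \<Longrightarrow> \<exists>S S' S''.
    (\<forall>x. (S has_real_derivative S' x) (at x)) \<and> (\<forall>x. (S' has_real_derivative S'' x) (at x)) \<and>
    (\<forall>x. 0 < S x \<and> S x \<le> C / \<omega>) \<and>
    (\<forall>x. 1 / cosh (\<theta> * x) \<le> - S'' x + ((V1 (- x))\<^sup>2 + \<omega>\<^sup>2) * S x - 2 * V1 x * V1 (- x) * S (- x))"
    using strict_supersolution[OF assms(2)] by blast
  have "C0_norm R \<phi>1 \<phi>2 \<le> ennreal (C * inverse \<omega>) * C0_weighted_norm \<theta> R g1 g2"
    if R: "R > 1" and \<omega>: "\<omega> \<in> {0<..<\<omega>0}"
      and sol: "dirichlet_solution V1 V2 R \<omega> \<phi>1 \<phi>2 g1 g2" for R \<omega> \<phi>1 \<phi>2 g1 g2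
  proof (cases "C0_weighted_norm \<theta> R g1 g2 = \<infinity>")
    \<comment> \<open>The right-hand side is infinite because \<open>C * inverse \<omega>\<close> is
      positive; in the other case the norm is a real number \<open>G\<close>.\<close>
    case True
    then show ?thesis using C \<omega> by (simp add: ennreal_mult_top)
  next
    case False
    define G where "G = enn2real (C0_weighted_norm \<theta> R g1 g2)"
    have G: "C0_weighted_norm \<theta> R g1 g2 = ennreal G" "G \<ge> 0"
      using False by (auto simp: G_def less_top)
    have g: "\<bar>g1 x\<bar> \<le> G * (1 / cosh (\<theta> * x))" "\<bar>g2 x\<bar> \<le> G * (1 / cosh (\<theta> * x))"
      if "x \<in> {-R<..<R}" for x
    proof -
      have "ennreal (max \<bar>g1 x * cosh (\<theta> * x)\<bar> \<bar>g2 x * cosh (\<theta> * x)\<bar>) \<le> ennreal G"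
        unfolding G(1)[symmetric] C0_weighted_norm_def C0_norm_def
        by (rule SUP_upper2[OF that]) simp
      then have "max \<bar>g1 x * cosh (\<theta> * x)\<bar> \<bar>g2 x * cosh (\<theta> * x)\<bar> \<le> G"
        using G(2) by (simp add: ennreal_le_iff)
      then show "\<bar>g1 x\<bar> \<le> G * (1 / cosh (\<theta> * x))" "\<bar>g2 x\<bar> \<le> G * (1 / cosh (\<theta> * x))"
        by (auto simp: abs_mult pos_le_divide_eq)
    qed
    obtain S S' S'' where S: "\<And>x. (S has_real_derivative S' x) (at x)"
      "\<And>x. (S' has_real_derivative S'' x) (at x)" "\<And>x. 0 < S x" "\<And>x. S x \<le> C / \<omega>"
      "\<And>x. 1 / cosh (\<theta> * x) \<le> - S'' x + ((V1 (- x))\<^sup>2 + \<omega>\<^sup>2) * S x - 2 * V1 x * V1 (- x) * S (- x)"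
      using sup[OF \<omega>] by blast
    have T: "((\<lambda>x. S (- x)) has_real_derivative - S' (- x)) (at x)"
      "((\<lambda>x. - S' (- x)) has_real_derivative S'' (- x)) (at x)" for x
      using DERIV_mirror[of S "S' (- x)" x] DERIV_minus[OF DERIV_mirror[THEN iffD1, OF S(2)[of "- x"]]]
        S(1)[of "- x"] by auto
    have der: "(\<phi>1 has_real_derivative deriv \<phi>1 x) (at x)"
      "(deriv \<phi>1 has_real_derivative deriv (deriv \<phi>1) x) (at x)"
      "(\<phi>2 has_real_derivative deriv \<phi>2 x) (at x)"
      "(deriv \<phi>2 has_real_derivative deriv (deriv \<phi>2) x) (at x)" if "x \<in> {-R<..<R}" for x
      using sol that
      by (auto simp: dirichlet_solution_def C2_on_def DERIV_deriv_iff_field_differentiable)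
    have eq: "- deriv (deriv \<phi>1) x + ((V1 (- x))\<^sup>2 + \<omega>\<^sup>2) * \<phi>1 x + 2 * V1 x * V1 (- x) * \<phi>2 x = g1 x"
      "- deriv (deriv \<phi>2) x + ((V1 x)\<^sup>2 + \<omega>\<^sup>2) * \<phi>2 x + 2 * V1 x * V1 (- x) * \<phi>1 x = g2 x"
      if "x \<in> {-R<..<R}" for x
      using sol that by (auto simp: dirichlet_solution_def L_op_def V2 algebra_simps)
    have reg: "continuous_on {-R..R} \<phi>1" "continuous_on {-R..R} \<phi>2"
      "\<phi>1 (-R) = 0" "\<phi>1 R = 0" "\<phi>2 (-R) = 0" "\<phi>2 R = 0"
      using sol by (auto simp: dirichlet_solution_def)
    have S_reflect: "1 / cosh (\<theta> * x)
        \<le> - S'' (- x) + ((V1 x)\<^sup>2 + \<omega>\<^sup>2) * S (- x) - 2 * V1 x * V1 (- x) * S x" for x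
      using S(5)[of "- x"] by (simp add: mult_ac)
    have k: "0 \<le> 2 * V1 x * V1 (- x)" for x using V_pos[of x] V_pos[of "- x"] by simp
    have e: "0 < 1 / cosh (\<theta> * x)" for x by simp
    have bound: "\<bar>\<phi>1 x\<bar> \<le> G * S x" "\<bar>\<phi>2 x\<bar> \<le> G * S (- x)" if "x \<in> {-R<..<R}" for x
      using R G(2) that
      by (intro bound_by_strict_supersolution[OF der S(1,2) T eq S(5) S_reflect k e S(3) S(3) g reg]; auto)+
    have "max \<bar>\<phi>1 x\<bar> \<bar>\<phi>2 x\<bar> \<le> C * inverse \<omega> * G" if "x \<in> {-R<..<R}" for x
    proof -
      have "G * S x \<le> G * (C / \<omega>)" "G * S (- x) \<le> G * (C / \<omega>)"
        by (intro mult_left_mono S(4) G(2))+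
      with bound[OF that] show ?thesis by (simp add: divide_inverse mult_ac)
    qed
    then have "C0_norm R \<phi>1 \<phi>2 \<le> ennreal (C * inverse \<omega> * G)"
      unfolding C0_norm_def by (intro SUP_least ennreal_leI)
    also have "\<dots> = ennreal (C * inverse \<omega>) * ennreal G"
      using C \<omega> G(2) by (intro ennreal_mult) auto
    finally show ?thesis unfolding G(1) .
  qed
  then show ?thesis
    using C by (intro exI[of _ C] exI[of _ 1] exI[of _ \<omega>0]) auto
qed

end
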